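(* Let $X\sim\operatorname{GP}(\sigma,\gamma,\pi,\ell)$ be a $d$-variate generalized Pareto random vector. Then, for any $x\in[0,\infty)^d$, $$\Pr(\exists j=1,\dots,d:\ X_j>x_j)=\ell\{\Pr(X_1>x_1),\dots,\Pr(X_d>x_d)\},$$ $$\Pr(\forall j=1,\dots,d:\ X_j>x_j)=R\{\Pr(X_1>x_1),\dots,\Pr(X_d>x_d)\},$$ where $R$ is the tail copula associated to $\ell$.
   Context: Conventions: operations and order relations between vectors are componentwise; $a\wedge b=\min(a,b)$. If $\gamma=0$, $(1+\gamma x)^{-1/\gamma}$ is read as $e^{-x}$. A function $\ell:[0,\infty)^d\to[0,\infty)$ is a stable tail dependence function (stdf) if there is a random vector $V$ with values in $[0,\infty)^d$ and $\mathbb E[V_j]=1$ for all $j$ such that $\ell(y)=\mathbb E[\max_{j}(y_jV_j)]$ for all $y\in[0,\infty)^d$. For $\sigma\in(0,\infty)^d$, $\gamma\in\mathbb R^d$, $\pi\in(0,1]^d$ and a stdf $\ell$ with $\ell(\pi)=1$, put $\eta_j=-\sigma_j/\gamma_j$ if $\gamma_j>0$ and $\eta_j=-\infty$ if $\gamma_j\le 0$. $\operatorname{GP}(\sigma,\gamma,\pi,\ell)$ is the probability distribution concentrated on $\{x\in[-\infty,\infty)^d:x\ge\eta,\ x_j>0\text{ for some }j\}$ whose cdf $H$ satisfies $H(x)=\ell\{\pi(1+\gamma\tfrac{x\wedge 0}{\sigma})^{-1/\gamma}\}-\ell\{\pi(1+\gamma\tfrac{x}{\sigma})^{-1/\gamma}\}$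 for all $x\in\mathbb R^d$ with $\sigma_j+\gamma_jx_j>0$ for all $j$. The tail copula $R:[0,\infty)^d\to[0,\infty)$ associated to a stdf $\ell$ is $R(y)=\Lambda([0,y_1]\times\cdots\times[0,y_d])$, where $\Lambda$ is the unique measure on $[0,\infty]^d\setminus\{(\infty,\dots,\infty)\}$ determined by $\Lambda([0,\infty]^d\setminus\prod_j[y_j,\infty])=\ell(y)$. Equivalently, by inclusion–exclusion, $R(y)=\sum_{\varnothing\ne J\subset\{1,\dots,d\}}(-1)^{|J|-1}\,\ell\bigl((y_j\mathbf 1_{\{j\in J\}})_{j=1}^d\bigr)$. *)

theory Defs
  imports "HOL-Probability.Probability"
begin

text \<open>
  Vectors indexed by \<open>{1..d}\<close> are functions on a finite index type \<open>'d\<close>, so that real,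
  \<open>[-\<infinity>,\<infinity>]\<close>- and \<open>[0,\<infinity>]\<close>-valued vectors (\<open>real\<close>, \<open>ereal\<close>, \<open>ennreal\<close>) are treated alike,
  always with the product Borel sigma-algebra. A function \<open>l\<close> on \<open>[0,\<infinity>)\<^sup>d\<close> is a total function
  whose values at vectors with a negative entry are irrelevant.
\<close>

text \<open>The measure \<open>P\<close> is the law of the generating random vector.\<close>

definition is_stdf :: "(('d::finite \<Rightarrow> real) \<Rightarrow> real) \<Rightarrow> bool" where
  "is_stdf l \<longleftrightarrow>
    (\<exists>P :: ('d \<Rightarrow> real) measure.
       prob_space P \<and> sets P = sets (\<Pi>\<^sub>M j\<in>UNIV. borel) \<and>
       (AE v in P. \<forall>j. 0 \<le> v j) \<and>
       (\<forall>j. integrable P (\<lambda>v. v j) \<and> (\<integral>v. v j \<partial>P) = 1) \<and>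
       (\<forall>y. (\<forall>j. 0 \<le> y j) \<longrightarrow> l y = (\<integral>v. (MAX j. y j * v j) \<partial>P)))"

text \<open>The power \<open>(1 + \<gamma> t) powr (- 1 / \<gamma>)\<close>, read as \<open>exp (- t)\<close> if \<open>\<gamma> = 0\<close>; only meant for \<open>1 + \<gamma> t > 0\<close>.\<close>

definition gp_pow :: "real \<Rightarrow> real \<Rightarrow> real" where
  "gp_pow \<gamma> t = (if \<gamma> = 0 then exp (- t) else (1 + \<gamma> * t) powr (- 1 / \<gamma>))"

definition gp_lower :: "real \<Rightarrow> real \<Rightarrow> ereal" where
  "gp_lower \<sigma> \<gamma> = (if \<gamma> > 0 then ereal (- \<sigma> / \<gamma>) else - \<infinity>)"

definition is_GP ::
  "('d::finite \<Rightarrow> real) \<Rightarrow> ('d \<Rightarrow> real) \<Rightarrow> ('d \<Rightarrow> real) \<Rightarrow> (('d \<Rightarrow> real) \<Rightarrow> real)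
    \<Rightarrow> ('d \<Rightarrow> ereal) measure \<Rightarrow> bool" where
  "is_GP \<sigma> \<gamma> \<pi> l \<mu> \<longleftrightarrow>
     prob_space \<mu> \<and> sets \<mu> = sets (\<Pi>\<^sub>M j\<in>UNIV. borel) \<and>
     (AE z in \<mu>. (\<forall>j. gp_lower (\<sigma> j) (\<gamma> j) \<le> z j \<and> z j < \<infinity>) \<and> (\<exists>j. 0 < z j)) \<and>
     (\<forall>x :: 'd \<Rightarrow> real. (\<forall>j. 0 < \<sigma> j + \<gamma> j * x j) \<longrightarrow>
        measure \<mu> {z \<in> space \<mu>. \<forall>j. z j \<le> ereal (x j)} =
          l (\<lambda>j. \<pi> j * gp_pow (\<gamma> j) (min (x j) 0 / \<sigma> j))
          - l (\<lambda>j. \<pi> j * gp_pow (\<gamma> j) (x j / \<sigma> j)))"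

text \<open>
  The exponent measure lives on \<open>[0,\<infinity>]\<^sup>d\<close> without the point \<open>(\<infinity>,\<dots>,\<infinity>)\<close>. It exists and is unique
  whenever \<open>l\<close> is a stable tail dependence function.
\<close>

definition is_exponent_measure ::
  "(('d::finite \<Rightarrow> real) \<Rightarrow> real) \<Rightarrow> ('d \<Rightarrow> ennreal) measure \<Rightarrow> bool" where
  "is_exponent_measure l \<Lambda> \<longleftrightarrow>
     sets \<Lambda> = sets (restrict_space (\<Pi>\<^sub>M j\<in>UNIV. borel) (UNIV - {\<lambda>_. \<infinity>})) \<and>
     (\<forall>y. (\<forall>j. 0 \<le> y j) \<longrightarrow>
        emeasure \<Lambda> (UNIV - (\<Pi> j\<in>UNIV. {ennreal (y j)..\<infinity>})) = ennreal (l y))"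

definition exponent_measure ::
  "(('d::finite \<Rightarrow> real) \<Rightarrow> real) \<Rightarrow> ('d \<Rightarrow> ennreal) measure" where
  "exponent_measure l = (THE \<Lambda>. is_exponent_measure l \<Lambda>)"

definition tail_copula :: "(('d::finite \<Rightarrow> real) \<Rightarrow> real) \<Rightarrow> ('d \<Rightarrow> real) \<Rightarrow> real" where
  "tail_copula l y = measure (exponent_measure l) (\<Pi> j\<in>UNIV. {0..ennreal (y j)})"

end

theory Submission
  imports Defs
begin

text \<open>
  For thresholds \<open>x \<ge> 0\<close> below the upper endpoints, the cdf of the generalized Pareto law gives
  \<open>\<mu> (\<exists>j. X\<^sub>j > x\<^sub>j) = l (\<pi> u)\<close>, where \<open>u\<^sub>j\<close> is the survival power at \<open>x\<^sub>j\<close>. Letting some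
  thresholds increase to their endpoints, where the power vanishes, and using that \<open>l\<close> is Lipschitz,
  one obtains \<open>\<mu> (\<exists>j\<in>J. X\<^sub>j > x\<^sub>j) = l (p 1\<^sub>J)\<close> for every \<open>J\<close>, where \<open>p\<^sub>j = \<mu> (X\<^sub>j > x\<^sub>j)\<close>; this
  also covers thresholds beyond the endpoint, for which \<open>p\<^sub>j = 0\<close>. The exponent measure gives
  the same masses \<open>l (p 1\<^sub>J)\<close> to the unions of the sets \<open>{z. z\<^sub>j < p\<^sub>j}\<close>. Since masses of finite unions
  determine masses of finite intersections, the joint exceedance probability is the exponent measure
  of \<open>{z. \<forall>j. z\<^sub>j < p\<^sub>j}\<close>, which is the tail copula at \<open>p\<close> because the boundary is a null set.
\<close>

section \<open>Measures of finite intersections from measures of finite unions\<close>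

lemma measure_INT_eq_if_measure_UN_eq:
  assumes "finite I" "I \<noteq> {}"
    and A: "\<And>i. i \<in> I \<Longrightarrow> A i \<in> fmeasurable M"
    and B: "\<And>i. i \<in> I \<Longrightarrow> B i \<in> fmeasurable N"
    and eq: "\<And>J. J \<subseteq> I \<Longrightarrow> J \<noteq> {} \<Longrightarrow> measure M (\<Union>i\<in>J. A i) = measure N (\<Union>i\<in>J. B i)"
  shows "measure M (\<Inter>i\<in>I. A i) = measure N (\<Inter>i\<in>I. B i)"
proof -
  \<comment> \<open>The extra union makes the induction close under \<open>\<mu> (A \<inter> B) = \<mu> A + \<mu> B - \<mu> (A \<union> B)\<close>.\<close>
  have *: "finite K \<Longrightarrow> K \<noteq> {} \<Longrightarrow> K \<subseteq> I \<Longrightarrow> J \<subseteq> I \<Longrightarrow>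
      measure M ((\<Inter>i\<in>K. A i) \<union> (\<Union>i\<in>J. A i)) = measure N ((\<Inter>i\<in>K. B i) \<union> (\<Union>i\<in>J. B i))" for K J
  proof (induction K arbitrary: J rule: finite_ne_induct)
    case (singleton k)
    then show ?case
      using eq[of "insert k J"] by simp
  next
    case (insert k K)
    have fin: "finite J"
      using insert.prems \<open>finite I\<close> finite_subset by blast
    \<comment> \<open>The formula is applied to the union over \<open>insert k J\<close> and to the
      set belonging to \<open>K\<close> and \<open>J\<close>. Their intersection belongs to
      \<open>insert k K\<close> and \<open>J\<close>, their union to \<open>K\<close> and
      \<open>insert k J\<close>; hence the induction hypothesis is needed for two different
      \<open>J\<close>.\<close>
    have split: "measure L ((\<Inter>i\<in>insert k K. C i) \<union> (\<Union>i\<in>J. C i)) =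
        measure L (\<Union>i\<in>insert k J. C i) + measure L ((\<Inter>i\<in>K. C i) \<union> (\<Union>i\<in>J. C i))
        - measure L ((\<Inter>i\<in>K. C i) \<union> (\<Union>i\<in>insert k J. C i))"
      if "\<And>i. i \<in> I \<Longrightarrow> C i \<in> fmeasurable L" for C :: "'a \<Rightarrow> 'x set" and L
    proof -
      have U: "(\<Union>i\<in>J'. C i) \<in> fmeasurable L" if "J' \<subseteq> I" for J'
        using that \<open>\<And>i. i \<in> I \<Longrightarrow> C i \<in> fmeasurable L\<close> finite_subset[OF _ \<open>finite I\<close>]
        by (intro fmeasurable.finite_UN) auto
      have "(\<Inter>i\<in>K. C i) \<in> fmeasurable L"
        using insert that by (intro fmeasurable.finite_INT) auto
      then have meas: "(\<Inter>i\<in>K. C i) \<union> (\<Union>i\<in>J. C i) \<in> fmeasurable L"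
        using U[of J] insert.prems by (intro fmeasurable.Un) auto
      have "measure L ((\<Union>i\<in>insert k J. C i) \<union> ((\<Inter>i\<in>K. C i) \<union> (\<Union>i\<in>J. C i))) =
          measure L (\<Union>i\<in>insert k J. C i) + measure L ((\<Inter>i\<in>K. C i) \<union> (\<Union>i\<in>J. C i))
          - measure L ((\<Union>i\<in>insert k J. C i) \<inter> ((\<Inter>i\<in>K. C i) \<union> (\<Union>i\<in>J. C i)))"
        using U[of "insert k J"] meas insert.prems measure_Un3 by auto
      moreover have "(\<Union>i\<in>insert k J. C i) \<union> ((\<Inter>i\<in>K. C i) \<union> (\<Union>i\<in>J. C i)) =
          (\<Inter>i\<in>K. C i) \<union> (\<Union>i\<in>insert k J. C i)"
        by blast
      moreover have "(\<Union>i\<in>insert k J. C i) \<inter> ((\<Inter>i\<in>K. C i) \<union> (\<Union>i\<in>J. C i)) =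
          (\<Inter>i\<in>insert k K. C i) \<union> (\<Union>i\<in>J. C i)"
        by blast
      ultimately show ?thesis
        by simp
    qed
    have "insert k J \<subseteq> I" "K \<subseteq> I" "J \<subseteq> I"
      using insert.prems by auto
    then show ?case
      unfolding split[OF A, simplified] split[OF B, simplified]
      using insert.IH[of J] insert.IH[of "insert k J"] eq[of "insert k J"]
        split[of A M, OF A] split[of B N, OF B] by simp
  qed
  show ?thesis
    using *[of I "{}"] \<open>finite I\<close> \<open>I \<noteq> {}\<close> by simp
qed

section \<open>Uniqueness of the exponent measure\<close>

lemma Compl_Pi_atLeast_eq:
  "UNIV - (\<Pi> j\<in>UNIV. {ennreal (y j)..\<infinity>}) = {z :: 'd \<Rightarrow> ennreal. \<exists>j. z j < ennreal (y j)}"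
  by (auto simp: Pi_iff not_le leD)

lemma ennreal_max: "ennreal (max a b) = max (ennreal a) (ennreal b)"
  by (simp add: max_of_mono mono_def ennreal_leI)

abbreviation nontop :: "('d \<Rightarrow> ennreal) set" where
  "nontop \<equiv> UNIV - {\<lambda>_. \<infinity>}"

text \<open>Differences of the sets on which an exponent measure is prescribed; unlike the latter, they are
  stable under intersection and hence determine the measure.\<close>

definition exponent_generator :: "('d::finite \<Rightarrow> ennreal) set set" where
  "exponent_generator = {{z. (\<exists>j. z j < ennreal (real n)) \<and> (\<forall>j. ennreal (y j) \<le> z j)} |n y. \<forall>j. 0 \<le> y j}"

text \<open>The level \<open>n\<close> is common to all coordinates, so the sets where some
  coordinate lies below the level form a chain and intersect in the smaller one; levels varying with
  the coordinate would produce mixed terms. Lower bounds combine by maxima.\<close>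

lemma Int_stable_exponent_generator: "Int_stable (exponent_generator :: ('d::finite \<Rightarrow> ennreal) set set)"
proof (rule Int_stableI)
  fix a b :: "('d \<Rightarrow> ennreal) set"
  assume "a \<in> exponent_generator" "b \<in> exponent_generator"
  then obtain m y n z where a: "a = {u. (\<exists>j. u j < ennreal (real m)) \<and> (\<forall>j. ennreal (y j) \<le> u j)}" "\<forall>j. 0 \<le> y j"
    and b: "b = {u. (\<exists>j. u j < ennreal (real n)) \<and> (\<forall>j. ennreal (z j) \<le> u j)}" "\<forall>j. 0 \<le> z j"
    unfolding exponent_generator_def by blast
  have mono: "u < ennreal (real m) \<Longrightarrow> m \<le> n \<Longrightarrow> u < ennreal (real n)" for u m n
    by (simp add: order_less_le_trans ennreal_leI)
  have "a \<inter> b = {u. (\<exists>j. u j < ennreal (real (min m n))) \<and> (\<forall>j. ennreal (max (y j) (z j)) \<le> u j)}"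
    unfolding a b using mono[of _ m n] mono[of _ n m] by (cases "m \<le> n") (auto simp: ennreal_max min_def)
  then show "a \<inter> b \<in> exponent_generator"
    unfolding exponent_generator_def using a(2) b(2) by (auto intro!: exI[of _ "min m n"] exI[of _ "\<lambda>j. max (y j) (z j)"] simp: le_max_iff_disj)
qed

lemma exponent_generator_subset: "exponent_generator \<subseteq> Pow nontop"
  unfolding exponent_generator_def by auto

lemma sets_exists_less_ennreal:
  "{z :: 'd::finite \<Rightarrow> ennreal. \<exists>j. z j < ennreal (y j)} \<in> sets (restrict_space (\<Pi>\<^sub>M j\<in>UNIV. borel) nontop)"
proof -
  have "{z \<in> space (\<Pi>\<^sub>M j\<in>UNIV. borel). \<exists>j. z j < ennreal (y j)} \<in> sets (\<Pi>\<^sub>M j\<in>(UNIV::'d set). borel)"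
    by measurable
  then show ?thesis
    by (auto simp: sets_restrict_space space_PiM image_iff intro!: bexI[of _ "{z. \<exists>j. z j < ennreal (y j)}"])
qed

text \<open>Each generator is a difference of two measurable sets. Conversely, all coordinates are
  measurable for the generated sigma-algebra, so it contains the trace on \<open>nontop\<close> of
  every product-measurable set.\<close>

lemma sets_exponent_generator:
  "sets (restrict_space (\<Pi>\<^sub>M j\<in>(UNIV::'d::finite set). borel) nontop) = sigma_sets nontop exponent_generator"
    (is "sets ?R = sigma_sets ?\<Omega> ?E")
proof
  have "a \<in> sets ?R" if aE: "a \<in> ?E" for a
  proof -
    obtain n y where a: "a = {z. (\<exists>j. z j < ennreal (real n)) \<and> (\<forall>j. ennreal (y j) \<le> z j)}"
      using aE unfolding exponent_generator_def by blast
    have "a = {z. \<exists>j. z j < ennreal (real n)} - {z. \<exists>j. z j < ennreal (y j)}"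
      unfolding a by (auto simp: not_less[symmetric])
    then show ?thesis
      using sets_exists_less_ennreal[of y] sets_exists_less_ennreal[of "\<lambda>_. real n"] by auto
  qed
  moreover have "space ?R = ?\<Omega>"
    by (simp add: space_restrict_space space_PiM)
  ultimately show "sigma_sets ?\<Omega> ?E \<subseteq> sets ?R"
    using sets.sigma_sets_subset[of ?E ?R] by auto
next
  let ?S = "sigma ?\<Omega> ?E"
  have sets_S: "sets ?S = sigma_sets ?\<Omega> ?E" and space_S: "space ?S = ?\<Omega>"
    by (rule sets_measure_of[OF exponent_generator_subset], rule space_measure_of[OF exponent_generator_subset])
  have real: "{z \<in> ?\<Omega>. ennreal r \<le> z j} \<in> sets ?S" if "0 \<le> r" for r j
  proof -
    \<comment> \<open>A point of \<open>nontop\<close> has a finite coordinate, so the union over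
      \<open>n\<close> removes the bound from above and only the lower bound on coordinate
      \<open>j\<close> remains.\<close>
    let ?G = "\<lambda>n. {z. (\<exists>k. z k < ennreal (real n)) \<and> (\<forall>k. ennreal (if k = j then r else 0) \<le> z k)}"
    have "{z \<in> ?\<Omega>. ennreal r \<le> z j} = (\<Union>n. ?G n)"
    proof (intro set_eqI iffI)
      fix z assume z: "z \<in> {z \<in> ?\<Omega>. ennreal r \<le> z j}"
      then obtain k where "z k \<noteq> \<infinity>"
        by (auto simp: fun_eq_iff)
      then obtain n :: nat where "z k < of_nat n"
        by (metis ennreal_Ex_less_of_nat infinity_ennreal_def top.not_eq_extremum)
      then show "z \<in> (\<Union>n. ?G n)"
        using z by (auto simp: ennreal_of_nat_eq_real_of_nat intro!: exI[of _ n])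
    next
      fix z assume "z \<in> (\<Union>n. ?G n)"
      then show "z \<in> {z \<in> ?\<Omega>. ennreal r \<le> z j}"
        by auto (metis (full_types))
    qed
    moreover have "?G n \<in> ?E" for n
      unfolding exponent_generator_def
      by (intro CollectI exI[of _ n] exI[of _ "\<lambda>k. if k = j then r else 0"]) (simp add: that)
    then have "?G n \<in> sets ?S" for n
      unfolding sets_S by auto
    then have "(\<Union>n. ?G n) \<in> sets ?S"
      by blast
    ultimately show ?thesis
      by simp
  qed
  have "(\<lambda>z. z) \<in> measurable ?S (\<Pi>\<^sub>M j\<in>(UNIV::'d set). borel)"
  proof (rule measurable_PiM_single')
    show "(\<lambda>z. z j) \<in> measurable ?S borel" for j
    proof (rule borel_measurableI_ge)
      fix c :: ennreal
      show "{z \<in> space ?S. c \<le> z j} \<in> sets ?S"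
      proof (cases c)
        case (real r)
        then show ?thesis
          unfolding space_S using \<open>0 \<le> r \<Longrightarrow> {z \<in> ?\<Omega>. ennreal r \<le> z j} \<in> sets ?S\<close> by simp
      next
        case top
        \<comment> \<open>The infinite level is not covered by \<open>real\<close>; it is reached
          through all integer levels.\<close>
        have "{z \<in> ?\<Omega>. c \<le> z j} = (\<Inter>n. {z \<in> ?\<Omega>. ennreal (real n) \<le> z j})"
          unfolding top
          by (auto simp: top_unique) (metis ennreal_Ex_less_of_nat ennreal_of_nat_eq_real_of_nat not_le top.not_eq_extremum)
        also have "\<dots> \<in> sets ?S"
          using real by (intro sets.countable_INT) auto
        finally show ?thesis
          unfolding space_S .
      qed
    qed
  qed (simp add: space_PiM)
  then show "sets ?R \<subseteq> sigma_sets ?\<Omega> ?E"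
    unfolding sets_restrict_space sets_S[symmetric]
    by (auto dest!: measurable_sets simp: space_S[simplified] vimage_def Int_commute)
qed

text \<open>\<open>l\<close> fixes the mass of every generator, and the generators with lower bound
  zero exhaust \<open>nontop\<close> by sets of finite mass, so the uniqueness theorem for
  pi-systems applies.\<close>

lemma is_exponent_measure_unique:
  fixes l :: "('d::finite \<Rightarrow> real) \<Rightarrow> real"
  assumes L: "is_exponent_measure l L" and L': "is_exponent_measure l L'"
  shows "L = L'"
proof (rule measure_eqI_generator_eq[where \<Omega>=nontop and E=exponent_generator and A="\<lambda>n. {z :: 'd \<Rightarrow> ennreal. \<exists>j. z j < ennreal (real n)}"])
  have em: "emeasure N {z. (\<exists>j. z j < ennreal (real n)) \<and> (\<forall>j. ennreal (y j) \<le> z j)} =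
      ennreal (l (\<lambda>j. max (real n) (y j))) - ennreal (l y)"
    if N: "is_exponent_measure l N" and y: "\<forall>j. 0 \<le> y j" for N n y
  proof -
    have *: "emeasure N {z. \<exists>j. z j < ennreal (y j)} = ennreal (l y)"
        "{z. \<exists>j. z j < ennreal (y j)} \<in> sets N"
      if "\<forall>j. 0 \<le> y j" for y
      using N that sets_exists_less_ennreal[of y] unfolding is_exponent_measure_def Compl_Pi_atLeast_eq by auto
    \<comment> \<open>Raising the upper level from \<open>n\<close> to \<open>max n (y j)\<close>
      only adds points with some coordinate below \<open>y\<close>, which the difference removes.
      The two prescribed sets thereby become nested.\<close>
    have "{z. (\<exists>j. z j < ennreal (real n)) \<and> (\<forall>j. ennreal (y j) \<le> z j)} =
        {z. \<exists>j. z j < ennreal (max (real n) (y j))} - {z. \<exists>j. z j < ennreal (y j)}"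
      using y by (auto simp: ennreal_max less_max_iff_disj not_less leD)
    also have "emeasure N \<dots> = ennreal (l (\<lambda>j. max (real n) (y j))) - ennreal (l y)"
      using y *[of y] *[of "\<lambda>j. max (real n) (y j)"]
      by (subst emeasure_Diff) (auto simp: ennreal_max less_max_iff_disj le_max_iff_disj)
    finally show ?thesis .
  qed
  show "emeasure L X = emeasure L' X" if "X \<in> exponent_generator" for X
    using that em[OF L] em[OF L'] unfolding exponent_generator_def by auto
  show "range (\<lambda>n. {z :: 'd \<Rightarrow> ennreal. \<exists>j. z j < ennreal (real n)}) \<subseteq> exponent_generator"
    unfolding exponent_generator_def by (auto intro!: exI[of _ "\<lambda>_. 0"])
  show "(\<Union>n. {z :: 'd \<Rightarrow> ennreal. \<exists>j. z j < ennreal (real n)}) = nontop"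
  proof (intro set_eqI iffI)
    fix z :: "'d \<Rightarrow> ennreal" assume "z \<in> nontop"
    then obtain j where "z j < \<infinity>"
      by (auto simp: fun_eq_iff top.not_eq_extremum)
    then obtain n where "z j < of_nat n"
      using ennreal_Ex_less_of_nat by (auto simp: infinity_ennreal_def)
    then show "z \<in> (\<Union>n. {z. \<exists>j. z j < ennreal (real n)})"
      by (auto simp: ennreal_of_nat_eq_real_of_nat)
  qed auto
  show "emeasure L {z. \<exists>j. z j < ennreal (real n)} \<noteq> \<infinity>" for n
  proof -
    have "emeasure L {z. \<exists>j. z j < ennreal (real n)} = ennreal (l (\<lambda>_. real n))"
      using L unfolding is_exponent_measure_def Compl_Pi_atLeast_eq by simp
    then show ?thesis
      by simp
  qed
  show "sets L = sigma_sets nontop exponent_generator" "sets L' = sigma_sets nontop exponent_generator"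
    using L L' unfolding is_exponent_measure_def sets_exponent_generator by blast+
qed (fact Int_stable_exponent_generator exponent_generator_subset)+

lemma exponent_measure_eqI:
  "is_exponent_measure l L \<Longrightarrow> exponent_measure l = L"
  unfolding exponent_measure_def using is_exponent_measure_unique by blast

section \<open>The exponent measure built from a generating random vector\<close>

text \<open>If \<open>v = 0\<close>, the quotient is \<infinity> and the product is 0, so both sides
  fail because \<open>t > 0\<close>.\<close>

lemma divide_ennreal_less_le_iff:
  assumes "0 < t" "0 \<le> v" "0 \<le> y"
  shows "ennreal t / ennreal v < ennreal y \<longleftrightarrow> t < y * v"
    and "ennreal t / ennreal v \<le> ennreal y \<longleftrightarrow> t \<le> y * v"
  using assms by (cases "v = 0"; simp add: divide_ennreal ennreal_less_iff field_simps top_unique)+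

locale stdf_generator = prob_space P
  for P :: "('d::finite \<Rightarrow> real) measure" and l :: "('d \<Rightarrow> real) \<Rightarrow> real" +
  assumes sets_P [measurable_cong]: "sets P = sets (\<Pi>\<^sub>M j\<in>UNIV. borel)"
    and nonneg: "AE v in P. \<forall>j. 0 \<le> v j"
    and integrable_component: "integrable P (\<lambda>v. v j)"
    and mean_component: "(\<integral>v. v j \<partial>P) = 1"
    and stdf_eq: "(\<And>j. 0 \<le> y j) \<Longrightarrow> l y = (\<integral>v. (MAX j. y j * v j) \<partial>P)"
begin

lemma integrable_Max: "integrable P (\<lambda>v. MAX j. y j * v j)"
  by (rule integrable_MAX) (auto intro: integrable_component)

text \<open>For nonnegative \<open>v\<close> the maximum is \<open>c * v j\<close>, whose mean is
  \<open>c\<close>. This later identifies the marginal exceedance probabilities, and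
  \<open>c = 0\<close> shows that \<open>l\<close> vanishes at the origin.\<close>

lemma stdf_single:
  assumes "0 \<le> c"
  shows "l (\<lambda>k. if k = j then c else 0) = c"
proof -
  have "l (\<lambda>k. if k = j then c else 0) = (\<integral>v. (MAX k. (if k = j then c else 0) * v k) \<partial>P)"
    using assms by (intro stdf_eq) auto
  also have "\<dots> = (\<integral>v. c * v j \<partial>P)"
  proof (rule integral_cong_AE)
    show "AE v in P. (MAX k. (if k = j then c else 0) * v k) = c * v j"
      using nonneg
    proof eventually_elim
      case (elim v)
      have "0 \<le> c * v j"
        using elim assms by simp
      then show ?case
        by (intro Max_eqI) auto
    qed
  qed measurable
  also have "\<dots> = c"
    using mean_component by simp
  finally show ?thesis .
qed

text \<open>Replacing \<open>z\<close> by \<open>y\<close> changes each term of the maximum by at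
  most \<open>\<bar>y j - z j\<bar> * v j\<close>, and the components of \<open>v\<close> have mean
  one.\<close>

lemma stdf_lipschitz:
  assumes "\<And>j. 0 \<le> y j" "\<And>j. 0 \<le> z j"
  shows "l y \<le> l z + (\<Sum>j\<in>UNIV. \<bar>y j - z j\<bar>)"
proof -
  have "l y = (\<integral>v. (MAX j. y j * v j) \<partial>P)"
    using assms by (intro stdf_eq)
  also have "\<dots> \<le> (\<integral>v. (MAX j. z j * v j) + (\<Sum>j\<in>UNIV. \<bar>y j - z j\<bar> * v j) \<partial>P)"
  proof (rule integral_mono_AE)
    show "AE v in P. (MAX j. y j * v j) \<le> (MAX j. z j * v j) + (\<Sum>j\<in>UNIV. \<bar>y j - z j\<bar> * v j)"
      using nonneg
    proof eventually_elim
      case (elim v)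
      have "y k * v k \<le> (MAX j. z j * v j) + (\<Sum>j\<in>UNIV. \<bar>y j - z j\<bar> * v j)" for k
      proof -
        have "y k * v k \<le> z k * v k + \<bar>y k - z k\<bar> * v k"
          using elim by (metis abs_ge_self diff_le_eq add.commute distrib_right mult_right_mono)
        moreover have "z k * v k \<le> (MAX j. z j * v j)"
          by (intro Max_ge) auto
        moreover have "\<bar>y k - z k\<bar> * v k \<le> (\<Sum>j\<in>UNIV. \<bar>y j - z j\<bar> * v j)"
          using elim by (intro member_le_sum) auto
        ultimately show ?thesis
          by linarith
      qed
      then show ?case
        by (simp add: Max_le_iff)
    qed
  qed (intro integrable_Max Bochner_Integration.integrable_add Bochner_Integration.integrable_sum
      integrable_mult_right integrable_component)+
  also have "\<dots> = l z + (\<Sum>j\<in>UNIV. \<bar>y j - z j\<bar>)"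
    using assms integrable_Max[of z] integrable_component mean_component stdf_eq[of z]
    by (simp add: Bochner_Integration.integral_add Bochner_Integration.integral_sum)
  finally show ?thesis .
qed

lemma stdf_tendsto:
  assumes y: "\<And>n j. 0 \<le> y n j" and z: "\<And>j. 0 \<le> z j" and lim: "\<And>j. (\<lambda>n. y n j) \<longlonglongrightarrow> z j"
  shows "(\<lambda>n. l (y n)) \<longlonglongrightarrow> l z"
proof -
  have "(\<lambda>n. \<Sum>j\<in>UNIV. \<bar>y n j - z j\<bar>) \<longlonglongrightarrow> (\<Sum>j\<in>UNIV. \<bar>z j - z j\<bar>)"
    by (intro tendsto_intros lim)
  then have *: "(\<lambda>n. \<Sum>j\<in>UNIV. \<bar>y n j - z j\<bar>) \<longlonglongrightarrow> 0"
    by simp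
  have "norm (l (y n) - l z) \<le> (\<Sum>j\<in>UNIV. \<bar>y n j - z j\<bar>)" for n
    using stdf_lipschitz[of "y n" z] stdf_lipschitz[of z "y n"] y z by (simp add: abs_minus_commute abs_le_iff)
  then have "(\<lambda>n. l (y n) - l z) \<longlonglongrightarrow> 0"
    by (intro Lim_null_comparison[OF _ *]) auto
  then show ?thesis
    using LIM_zero_iff by blast
qed

text \<open>The image of Lebesgue measure times \<open>P\<close> under \<open>(t, v) \<mapsto> (t / v\<^sub>j)\<^sub>j\<close>; a vanishing \<open>v\<^sub>j\<close> gives
  \<open>\<infinity>\<close> because \<open>t > 0\<close>.\<close>

definition scaled_measure :: "('d \<Rightarrow> ennreal) measure" where
  "scaled_measure = restrict_space
     (distr (P \<Otimes>\<^sub>M restrict_space lborel {0<..}) (\<Pi>\<^sub>M j\<in>UNIV. borel)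
       (\<lambda>(v, t). \<lambda>j. ennreal t / ennreal (v j))) nontop"

text \<open>Tonelli: the mass of \<open>A\<close> is the mean length of its section in
  \<open>t\<close>. The section is described only for almost every \<open>v\<close> because
  \<open>v\<close> is nonnegative only almost surely.\<close>

lemma emeasure_scaled_measure:
  assumes A: "A \<in> sets (\<Pi>\<^sub>M j\<in>UNIV. borel)" "A \<subseteq> nontop"
    and sec: "AE v in P. {t. 0 < t \<and> (\<lambda>j. ennreal t / ennreal (v j)) \<in> A} = S v"
  shows "emeasure scaled_measure A = (\<integral>\<^sup>+v. emeasure lborel (S v) \<partial>P)"
proof -
  let ?L = "restrict_space lborel {0 :: real<..}"
  let ?f = "\<lambda>(v :: 'd \<Rightarrow> real, t). \<lambda>j. ennreal t / ennreal (v j)"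
  interpret L: sigma_finite_measure ?L
    by (intro sigma_finite_measure_restrict_space sigma_finite_lborel) simp
  have id: "(\<lambda>t. t) \<in> borel_measurable ?L"
    by (simp add: measurable_restrict_space1)
  have f: "?f \<in> measurable (P \<Otimes>\<^sub>M ?L) (\<Pi>\<^sub>M j\<in>UNIV. borel)"
  proof (rule measurable_PiM_single')
    show "(\<lambda>p. ?f p j) \<in> borel_measurable (P \<Otimes>\<^sub>M ?L)" for j
      using id by (auto simp: split_beta' intro!: borel_measurable_divide_ennreal measurable_compose[OF _ measurable_ennreal]
          measurable_compose[OF measurable_snd id])
  qed (simp add: space_PiM)
  have "{\<lambda>_. \<infinity>} = {z \<in> space (\<Pi>\<^sub>M j\<in>(UNIV :: 'd set). (borel :: ennreal measure)). \<forall>j. z j = \<infinity>}"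
    by (auto simp: space_PiM)
  also have "\<dots> \<in> sets (\<Pi>\<^sub>M j\<in>(UNIV :: 'd set). borel)"
    by measurable
  finally have top: "nontop \<in> sets (\<Pi>\<^sub>M j\<in>(UNIV :: 'd set). (borel :: ennreal measure))"
    using sets.compl_sets by (fastforce simp: space_PiM)
  have "emeasure scaled_measure A = emeasure (P \<Otimes>\<^sub>M ?L) (?f -` A \<inter> space (P \<Otimes>\<^sub>M ?L))"
    unfolding scaled_measure_def using top A f
    by (subst emeasure_restrict_space) (auto simp: emeasure_distr space_PiM)
  also have "\<dots> = (\<integral>\<^sup>+v. emeasure ?L (Pair v -` (?f -` A \<inter> space (P \<Otimes>\<^sub>M ?L))) \<partial>P)"
    using measurable_sets[OF f A(1)] by (rule L.emeasure_pair_measure_alt)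
  also have "\<dots> = (\<integral>\<^sup>+v. emeasure lborel (S v) \<partial>P)"
  proof (rule nn_integral_cong_AE)
    show "AE v in P. emeasure ?L (Pair v -` (?f -` A \<inter> space (P \<Otimes>\<^sub>M ?L))) = emeasure lborel (S v)"
      using sec AE_space
    proof eventually_elim
      case (elim v)
      then have "Pair v -` (?f -` A \<inter> space (P \<Otimes>\<^sub>M ?L)) = S v"
        by (auto simp: space_pair_measure space_restrict_space)
      moreover have "S v \<subseteq> {0<..}"
        using elim by auto
      ultimately show ?case
        by (simp add: emeasure_restrict_space)
    qed
  qed
  finally show ?thesis .
qed

text \<open>By \<open>divide_ennreal_less_le_iff\<close>, the section at \<open>v\<close> is the
  open interval from 0 to the maximum of \<open>y j * v j\<close>; the mean of its length is
  \<open>l y\<close>.\<close>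

lemma is_exponent_measure_scaled_measure: "is_exponent_measure l scaled_measure"
  unfolding is_exponent_measure_def Compl_Pi_atLeast_eq
proof (intro conjI allI impI)
  show "sets scaled_measure = sets (restrict_space (\<Pi>\<^sub>M j\<in>UNIV. borel) nontop)"
    unfolding scaled_measure_def by (simp add: sets_restrict_space)
next
  fix y :: "'d \<Rightarrow> real" assume y: "\<forall>j. 0 \<le> y j"
  have sets: "{z \<in> space (\<Pi>\<^sub>M j\<in>UNIV. borel). \<exists>j. z j < ennreal (y j)} \<in> sets (\<Pi>\<^sub>M j\<in>(UNIV :: 'd set). borel)"
    by measurable
  have nonneg_Max: "AE v in P. 0 \<le> (MAX j. y j * v j)"
    using nonneg by eventually_elim (use y in \<open>auto simp: Max_ge_iff\<close>)
  have "emeasure scaled_measure {z. \<exists>j. z j < ennreal (y j)} =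
      (\<integral>\<^sup>+v. emeasure lborel {0 <..< MAX j. y j * v j} \<partial>P)"
  proof (rule emeasure_scaled_measure)
    show "AE v in P. {t. 0 < t \<and> (\<lambda>j. ennreal t / ennreal (v j)) \<in> {z. \<exists>j. z j < ennreal (y j)}} =
        {0 <..< MAX j. y j * v j}"
      using nonneg by eventually_elim (use y in \<open>auto simp: divide_ennreal_less_le_iff Max_gr_iff\<close>)
  qed (use sets in \<open>auto simp: space_PiM\<close>)
  also have "\<dots> = (\<integral>\<^sup>+v. ennreal (MAX j. y j * v j) \<partial>P)"
    using nonneg_Max by (intro nn_integral_cong_AE) (auto elim!: eventually_mono)
  also have "\<dots> = ennreal (l y)"
    using nn_integral_eq_integral[OF integrable_Max nonneg_Max] stdf_eq y by simp
  finally show "emeasure scaled_measure {z. \<exists>j. z j < ennreal (y j)} = ennreal (l y)" .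
qed

lemma exponent_measure_eq: "exponent_measure l = scaled_measure"
  by (rule exponent_measure_eqI[OF is_exponent_measure_scaled_measure])

text \<open>With m the minimum of \<open>y j * v j\<close>, the closed box has section
  \<open>{0<..m}\<close> and the strict box \<open>{0<..<m}\<close>, which have equal length. The
  strict form matches the sets on which the exponent measure is prescribed.\<close>

lemma tail_copula_eq_less:
  assumes y: "\<And>j. 0 \<le> y j"
  shows "tail_copula l y = measure (exponent_measure l) {z. \<forall>j. z j < ennreal (y j)}"
proof -
  have 1: "{z \<in> space (\<Pi>\<^sub>M j\<in>UNIV. borel). \<forall>j. z j \<le> ennreal (y j)} \<in> sets (\<Pi>\<^sub>M j\<in>(UNIV :: 'd set). borel)"
      "{z \<in> space (\<Pi>\<^sub>M j\<in>UNIV. borel). \<forall>j. z j < ennreal (y j)} \<in> sets (\<Pi>\<^sub>M j\<in>(UNIV :: 'd set). borel)"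
    by measurable
  have "(\<lambda>_. \<infinity>) \<notin> {z :: 'd \<Rightarrow> ennreal. \<forall>j. z j \<le> ennreal (y j)}"
    by (simp add: top_unique)
  then have 2: "{z. \<forall>j. z j \<le> ennreal (y j)} \<subseteq> nontop"
    by blast
  then have 3: "{z. \<forall>j. z j < ennreal (y j)} \<subseteq> nontop"
    by (auto intro: less_imp_le)
  have nonneg_Min: "AE v in P. 0 \<le> (MIN j. y j * v j)"
    using nonneg by eventually_elim (use y in \<open>auto\<close>)
  have "emeasure scaled_measure {z. \<forall>j. z j \<le> ennreal (y j)} =
      (\<integral>\<^sup>+v. emeasure lborel {0 <.. MIN j. y j * v j} \<partial>P)"
    using nonneg 1 2 by (intro emeasure_scaled_measure) (auto simp: space_PiM elim!: eventually_mono
        simp: divide_ennreal_less_le_iff y)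
  also have "\<dots> = (\<integral>\<^sup>+v. emeasure lborel {0 <..< MIN j. y j * v j} \<partial>P)"
    using nonneg_Min by (intro nn_integral_cong_AE) (auto elim!: eventually_mono)
  also have "\<dots> = emeasure scaled_measure {z. \<forall>j. z j < ennreal (y j)}"
    using nonneg 1 3 by (intro emeasure_scaled_measure[symmetric]) (auto simp: space_PiM elim!: eventually_mono
        simp: divide_ennreal_less_le_iff y)
  finally have "emeasure scaled_measure {z. \<forall>j. z j \<le> ennreal (y j)} =
      emeasure scaled_measure {z. \<forall>j. z j < ennreal (y j)}" .
  moreover have "(\<Pi> j\<in>UNIV. {0..ennreal (y j)}) = {z. \<forall>j. z j \<le> ennreal (y j)}"
    by auto
  ultimately show ?thesis
    unfolding tail_copula_def exponent_measure_eq measure_def by simp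
qed

end

lemma is_stdfE:
  assumes "is_stdf l"
  obtains P where "stdf_generator P l"
  using assms unfolding is_stdf_def stdf_generator_def stdf_generator_axioms_def by blast

section \<open>Exceedance probabilities of the generalized Pareto law\<close>

text \<open>Thresholds increase to the upper endpoint, which is \<open>- \<sigma> / \<gamma>\<close>
  for \<gamma> < 0 and infinite otherwise. The third property places them below any threshold at or
  beyond the endpoint; for \<gamma> \<ge> 0 it is vacuous.\<close>

lemma gp_pow_tendsto_endpoint:
  assumes "0 < \<sigma>"
  obtains c :: "nat \<Rightarrow> real" where "\<And>n. 0 \<le> c n" "\<And>n. 0 < \<sigma> + \<gamma> * c n"
    "\<And>n r. \<sigma> + \<gamma> * r \<le> 0 \<Longrightarrow> 0 \<le> r \<Longrightarrow> c n < r"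
    "(\<lambda>n. gp_pow \<gamma> (c n / \<sigma>)) \<longlonglongrightarrow> 0"
proof (cases "\<gamma> < 0")
  case True
  \<comment> \<open>Chosen so that \<open>\<sigma> + \<gamma> * c n\<close> equals
    \<open>\<sigma> / (1 + n)\<close>, which is positive and tends to 0.\<close>
  define c where "c n = - \<sigma> / \<gamma> * (1 - 1 / (1 + real n))" for n
  have eq: "\<sigma> + \<gamma> * c n = \<sigma> / (1 + real n)" for n
  proof -
    have "\<sigma> + \<gamma> * c n = \<sigma> - \<sigma> * (1 - 1 / (1 + real n))"
      using True by (simp add: c_def)
    then show ?thesis
      by (simp add: algebra_simps)
  qed
  have le: "1 / (1 + real n) \<le> 1" for n
    by simp
  show ?thesis
  proof (rule that[of c])
    show "0 \<le> c n" for n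
      unfolding c_def using True assms le[of n] by (intro mult_nonneg_nonneg) (auto simp: divide_nonneg_neg)
    show pos: "0 < \<sigma> + \<gamma> * c n" for n
      unfolding eq using assms by simp
    show "c n < r" if "\<sigma> + \<gamma> * r \<le> 0" for n r
    proof -
      have "\<gamma> * r < \<gamma> * c n"
        using pos[of n] that by linarith
      then show ?thesis
        using True by (simp add: mult_less_cancel_left)
    qed
    have "1 + \<gamma> * (c n / \<sigma>) = 1 / (1 + real n)" for n
      using eq[of n] assms by (simp add: field_simps)
    then have "gp_pow \<gamma> (c n / \<sigma>) = (1 / (1 + real n)) powr (- 1 / \<gamma>)" for n
      using True by (simp add: gp_pow_def)
    \<comment> \<open>Since \<gamma> < 0, the exponent is positive and the power is continuous at 0
      from the right.\<close>
    moreover have "(\<lambda>n. (1 / (1 + real n)) powr (- 1 / \<gamma>)) \<longlonglongrightarrow> 0 powr (- 1 / \<gamma>)"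
    proof (rule tendsto_powr2)
      show "(\<lambda>n. 1 / (1 + real n)) \<longlonglongrightarrow> 0"
        by real_asymp
    qed (use True in \<open>auto simp: divide_pos_neg\<close>)
    ultimately show "(\<lambda>n. gp_pow \<gamma> (c n / \<sigma>)) \<longlonglongrightarrow> 0"
      by simp
  qed
next
  case False
  have *: "0 < \<sigma> + \<gamma> * r" if "0 \<le> r" for r
    using False that assms by (simp add: add_pos_nonneg)
  have "(\<lambda>n. gp_pow \<gamma> (real n / \<sigma>)) \<longlonglongrightarrow> 0"
  proof (cases "\<gamma> = 0")
    case True
    then show ?thesis
      using assms unfolding gp_pow_def by simp real_asymp
  next
    case False
    then have "0 < \<gamma>"
      using \<open>\<not> \<gamma> < 0\<close> by simp
    have "filterlim (\<lambda>n. 1 + \<gamma> * (real n / \<sigma>)) at_top sequentially"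
      using \<open>0 < \<gamma>\<close> assms by real_asymp
    then have "(\<lambda>n. (1 + \<gamma> * (real n / \<sigma>)) powr (- 1 / \<gamma>)) \<longlonglongrightarrow> 0"
      using \<open>0 < \<gamma>\<close> by (intro tendsto_neg_powr) auto
    then show ?thesis
      using False by (simp add: gp_pow_def)
  qed
  then show ?thesis
    using * by (intro that[of real]) (auto simp: not_le[symmetric])
qed

lemma gp_pow_nonneg: "0 \<le> gp_pow \<gamma> t"
  by (simp add: gp_pow_def)

context stdf_generator
begin

text \<open>For \<open>a \<ge> 0\<close> the first term of the cdf is \<open>l \<pi> = 1\<close>, so
  passing to the complement leaves the second term.\<close>

lemma measure_GP_exists_greater:
  assumes \<pi>: "l \<pi> = 1" and GP: "is_GP \<sigma> \<gamma> \<pi> l \<mu>"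
    and a: "\<And>j. 0 \<le> a j" "\<And>j. 0 < \<sigma> j + \<gamma> j * a j"
  shows "measure \<mu> {z. \<exists>j. ereal (a j) < z j} = l (\<lambda>j. \<pi> j * gp_pow (\<gamma> j) (a j / \<sigma> j))"
proof -
  interpret \<mu>: prob_space \<mu>
    using GP by (simp add: is_GP_def)
  have sets [measurable_cong]: "sets \<mu> = sets (\<Pi>\<^sub>M j\<in>UNIV. borel)"
    using GP by (simp add: is_GP_def)
  have space: "space \<mu> = UNIV"
    using sets_eq_imp_space_eq[OF sets] by (simp add: space_PiM)
  have "{z \<in> space \<mu>. \<forall>j. z j \<le> ereal (a j)} \<in> sets \<mu>"
    by measurable
  then have "measure \<mu> {z. \<exists>j. ereal (a j) < z j} = 1 - measure \<mu> {z \<in> space \<mu>. \<forall>j. z j \<le> ereal (a j)}"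
    by (subst \<mu>.prob_compl[symmetric]) (auto simp: space not_less[symmetric] intro!: arg_cong[where f="measure \<mu>"])
  moreover have "measure \<mu> {z \<in> space \<mu>. \<forall>j. z j \<le> ereal (a j)} =
      l (\<lambda>j. \<pi> j * gp_pow (\<gamma> j) (min (a j) 0 / \<sigma> j)) - l (\<lambda>j. \<pi> j * gp_pow (\<gamma> j) (a j / \<sigma> j))"
    using GP a(2) by (simp add: is_GP_def)
  moreover have "(\<lambda>j. \<pi> j * gp_pow (\<gamma> j) (min (a j) 0 / \<sigma> j)) = \<pi>"
    using a(1) by (auto simp: gp_pow_def min_absorb2)
  ultimately show ?thesis
    using \<pi> by simp
qed

text \<open>A coordinate outside \<open>K\<close> is dropped by moving its threshold to the upper endpoint.\<close>

lemma measure_GP_exists_greater_subset: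
  assumes \<sigma>: "\<And>j. 0 < \<sigma> j" and \<pi>: "\<And>j. 0 \<le> \<pi> j" "l \<pi> = 1" and GP: "is_GP \<sigma> \<gamma> \<pi> l \<mu>"
    and a: "\<And>j. 0 \<le> a j"
  shows "measure \<mu> {z. \<exists>j\<in>K. ereal (a j) < z j} =
    l (\<lambda>j. if j \<in> K \<and> 0 < \<sigma> j + \<gamma> j * a j then \<pi> j * gp_pow (\<gamma> j) (a j / \<sigma> j) else 0)"
proof -
  interpret \<mu>: prob_space \<mu>
    using GP by (simp add: is_GP_def)
  have sets [measurable_cong]: "sets \<mu> = sets (\<Pi>\<^sub>M j\<in>UNIV. borel)"
    using GP by (simp add: is_GP_def)
  have space: "space \<mu> = UNIV"
    using sets_eq_imp_space_eq[OF sets] by (simp add: space_PiM)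
  have meas: "{z. \<exists>j\<in>K. ereal (b j) < z j} \<in> sets \<mu>" for b and K :: "'d set"
  proof -
    have "{z \<in> space \<mu>. \<exists>j\<in>K. ereal (b j) < z j} \<in> sets \<mu>"
      by measurable
    then show ?thesis
      by (simp add: space)
  qed
  have "\<forall>j. \<exists>c :: nat \<Rightarrow> real. (\<forall>n. 0 \<le> c n) \<and> (\<forall>n. 0 < \<sigma> j + \<gamma> j * c n) \<and>
      (\<forall>n r. \<sigma> j + \<gamma> j * r \<le> 0 \<longrightarrow> 0 \<le> r \<longrightarrow> c n < r) \<and>
      (\<lambda>n. gp_pow (\<gamma> j) (c n / \<sigma> j)) \<longlonglongrightarrow> 0"
    using gp_pow_tendsto_endpoint[OF \<sigma>] by metis
  then obtain c :: "'d \<Rightarrow> nat \<Rightarrow> real" where c: "\<And>j n. 0 \<le> c j n" "\<And>j n. 0 < \<sigma> j + \<gamma> j * c j n"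
      "\<And>j n r. \<sigma> j + \<gamma> j * r \<le> 0 \<Longrightarrow> 0 \<le> r \<Longrightarrow> c j n < r"
      "\<And>j. (\<lambda>n. gp_pow (\<gamma> j) (c j n / \<sigma> j)) \<longlonglongrightarrow> 0"
    by metis
  let ?K = "{j \<in> K. 0 < \<sigma> j + \<gamma> j * a j}"
  \<comment> \<open>Besides the coordinates outside \<open>K\<close>, those in \<open>K\<close>
    whose threshold is at or beyond the endpoint are also sent to the endpoint.\<close>
  define b where "b n j = (if j \<in> ?K then a j else c j n)" for n j
  let ?q = "\<lambda>j. if j \<in> K \<and> 0 < \<sigma> j + \<gamma> j * a j then \<pi> j * gp_pow (\<gamma> j) (a j / \<sigma> j) else 0"
  let ?E = "\<lambda>n. {z. \<exists>j. ereal (b n j) < z j}"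
  let ?F = "\<lambda>n. {z. \<exists>j. ereal (c j n) < z j}"
  have "(\<lambda>n. \<pi> j * gp_pow (\<gamma> j) (b n j / \<sigma> j)) \<longlonglongrightarrow> ?q j" for j
    using tendsto_mult[OF tendsto_const c(4)[of j], of "\<pi> j"] by (auto simp: b_def)
  then have "(\<lambda>n. l (\<lambda>j. \<pi> j * gp_pow (\<gamma> j) (b n j / \<sigma> j))) \<longlonglongrightarrow> l ?q"
    using \<pi> gp_pow_nonneg by (intro stdf_tendsto) auto
  moreover have "measure \<mu> (?E n) = l (\<lambda>j. \<pi> j * gp_pow (\<gamma> j) (b n j / \<sigma> j))" for n
    by (rule measure_GP_exists_greater[OF \<pi>(2) GP]) (auto simp: b_def a c)
  ultimately have E: "(\<lambda>n. measure \<mu> (?E n)) \<longlonglongrightarrow> l ?q"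
    by simp
  \<comment> \<open>Sending all thresholds to their endpoints at once shows that the events
    \<open>?F n\<close> have vanishing probability.\<close>
  have "l (\<lambda>j. 0) = 0"
    using stdf_single[of 0] by simp
  moreover have "(\<lambda>n. \<pi> j * gp_pow (\<gamma> j) (c j n / \<sigma> j)) \<longlonglongrightarrow> 0" for j
    using tendsto_mult[OF tendsto_const c(4)[of j], of "\<pi> j"] by simp
  then have "(\<lambda>n. l (\<lambda>j. \<pi> j * gp_pow (\<gamma> j) (c j n / \<sigma> j))) \<longlonglongrightarrow> l (\<lambda>j. 0)"
    using \<pi> gp_pow_nonneg by (intro stdf_tendsto) auto
  moreover have "measure \<mu> (?F n) = l (\<lambda>j. \<pi> j * gp_pow (\<gamma> j) (c j n / \<sigma> j))" for n
    by (rule measure_GP_exists_greater[OF \<pi>(2) GP]) (auto simp: c)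
  ultimately have F: "(\<lambda>n. measure \<mu> (?F n)) \<longlonglongrightarrow> 0"
    by simp
  let ?m = "measure \<mu> {z. \<exists>j\<in>K. ereal (a j) < z j}"
  have c_less: "ereal (c j n) < u" if "\<not> 0 < \<sigma> j + \<gamma> j * a j" "ereal (a j) < u" for j n u
    using c(3)[of j "a j" n] a[of j] that by (meson ereal_less_eq(3) less_imp_le not_less order_le_less_trans)
  \<comment> \<open>Squeeze: the event is contained in \<open>?E n\<close>, and \<open>?E n\<close>
    exceeds it by at most \<open>?F n\<close>, whose probability tends to 0.\<close>
  have "{z. \<exists>j\<in>K. ereal (a j) < z j} \<subseteq> ?E n" for n
    using c_less unfolding b_def by auto
  then have "?m \<le> measure \<mu> (?E n)" for n
    using meas[of UNIV "b n"] by (intro \<mu>.finite_measure_mono) auto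
  then have "?m \<le> l ?q"
    using E by (intro LIMSEQ_le_const) auto
  moreover have "measure \<mu> (?E n) \<le> ?m + measure \<mu> (?F n)" for n
  proof -
    have "?E n \<subseteq> {z. \<exists>j\<in>K. ereal (a j) < z j} \<union> ?F n"
      unfolding b_def by (auto split: if_splits)
    then have "measure \<mu> (?E n) \<le> measure \<mu> ({z. \<exists>j\<in>K. ereal (a j) < z j} \<union> ?F n)"
      using meas[of UNIV "\<lambda>j. c j n"] meas[of K a] by (intro \<mu>.finite_measure_mono) auto
    also have "\<dots> \<le> ?m + measure \<mu> (?F n)"
      using meas[of UNIV "\<lambda>j. c j n"] meas[of K a] by (intro measure_Un_le) auto
    finally show ?thesis .
  qed
  then have "l ?q \<le> ?m + 0"
    using E F by (intro LIMSEQ_le[OF E tendsto_add[OF tendsto_const F]]) blast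
  ultimately show ?thesis
    by simp
qed

end

section \<open>Union and joint exceedance probabilities of the random vector\<close>

theorem proposition7p1:
  fixes \<sigma> \<gamma> \<pi> :: "'d::finite \<Rightarrow> real"
    and l :: "('d \<Rightarrow> real) \<Rightarrow> real"
    and M :: "'a measure"
    and X :: "'a \<Rightarrow> 'd \<Rightarrow> ereal"
    and x :: "'d \<Rightarrow> real"
  assumes "\<And>j. 0 < \<sigma> j"
    and "\<And>j. 0 < \<pi> j \<and> \<pi> j \<le> 1"
    and "is_stdf l"
    and "l \<pi> = 1"
    and "prob_space M"
    and "X \<in> measurable M (\<Pi>\<^sub>M j\<in>UNIV. borel)"
    and "is_GP \<sigma> \<gamma> \<pi> l (distr M (\<Pi>\<^sub>M j\<in>UNIV. borel) X)"
    and "\<And>j. 0 \<le> x j"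
  shows "\<P>(\<omega> in M. \<exists>j. X \<omega> j > ereal (x j)) =
           l (\<lambda>j. \<P>(\<omega> in M. X \<omega> j > ereal (x j))) \<and>
         \<P>(\<omega> in M. \<forall>j. X \<omega> j > ereal (x j)) =
           tail_copula l (\<lambda>j. \<P>(\<omega> in M. X \<omega> j > ereal (x j)))"
proof -
  obtain P where "stdf_generator P l"
    using is_stdfE[OF \<open>is_stdf l\<close>] .
  then interpret stdf_generator P l .
  interpret M: prob_space M
    by fact
  let ?\<mu> = "distr M (\<Pi>\<^sub>M j\<in>UNIV. borel) X"
  have [measurable]: "X \<in> measurable M (\<Pi>\<^sub>M j\<in>UNIV. borel)"
    by fact
  define p where "p j = \<P>(\<omega> in M. X \<omega> j > ereal (x j))" for j
  define q where "q j = (if 0 < \<sigma> j + \<gamma> j * x j then \<pi> j * gp_pow (\<gamma> j) (x j / \<sigma> j) else 0)" for j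
  \<comment> \<open>\<open>J = UNIV\<close> will give the first claim, singletons the marginal
    probabilities, and all \<open>J\<close> together the second claim.\<close>
  have meas: "\<P>(\<omega> in M. \<exists>j\<in>J. X \<omega> j > ereal (x j)) = l (\<lambda>j. if j \<in> J then q j else 0)" for J
  proof -
    have "{z \<in> space (\<Pi>\<^sub>M j\<in>UNIV. borel). \<exists>j\<in>J. ereal (x j) < z j} \<in> sets (\<Pi>\<^sub>M j\<in>(UNIV :: 'd set). borel)"
      by measurable
    then have "\<P>(\<omega> in M. \<exists>j\<in>J. X \<omega> j > ereal (x j)) = measure ?\<mu> {z. \<exists>j\<in>J. ereal (x j) < z j}"
      by (subst measure_distr) (auto simp: space_PiM intro!: arg_cong[where f="measure M"])
    also have "\<dots> = l (\<lambda>j. if j \<in> J \<and> 0 < \<sigma> j + \<gamma> j * x j then \<pi> j * gp_pow (\<gamma> j) (x j / \<sigma> j) else 0)"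
      using assms by (intro measure_GP_exists_greater_subset) (auto simp: less_imp_le)
    also have "(\<lambda>j. if j \<in> J \<and> 0 < \<sigma> j + \<gamma> j * x j then \<pi> j * gp_pow (\<gamma> j) (x j / \<sigma> j) else 0) =
        (\<lambda>j. if j \<in> J then q j else 0)"
      by (auto simp: q_def)
    finally show ?thesis .
  qed
  have q: "0 \<le> q j" for j
    using assms(2)[of j] gp_pow_nonneg by (simp add: q_def)
  \<comment> \<open>For a singleton \<open>J\<close>, the vector in \<open>meas\<close> has one
    possibly nonzero entry, so \<open>stdf_single\<close> evaluates \<open>l\<close> there.\<close>
  have "p = q"
  proof
    show "p j = q j" for j
      using meas[of "{j}"] stdf_single[OF q] by (simp add: p_def cong: if_cong)
  qed
  let ?A = "\<lambda>j. {\<omega> \<in> space M. X \<omega> j > ereal (x j)}"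
  let ?B = "\<lambda>j. {z. z j < ennreal (p j)}"
  let ?L = "exponent_measure l"
  have L: "emeasure ?L {z. \<exists>j. z j < ennreal (y j)} = ennreal (l y)" "{z. \<exists>j. z j < ennreal (y j)} \<in> sets ?L"
    if "\<And>j. 0 \<le> y j" for y
    using is_exponent_measure_scaled_measure that sets_exists_less_ennreal[of y]
    unfolding is_exponent_measure_def Compl_Pi_atLeast_eq exponent_measure_eq by auto
  \<comment> \<open>Nothing in \<open>ennreal\<close> lies below 0, so zero entries drop the
    coordinates outside \<open>J\<close> and the union becomes a set of prescribed mass.\<close>
  have B: "(\<Union>j\<in>J. ?B j) = {z. \<exists>j. z j < ennreal (if j \<in> J then q j else 0)}" for J
    by (auto simp: \<open>p = q\<close> split: if_splits)
  have "measure M (\<Inter>j. ?A j) = measure ?L (\<Inter>j. ?B j)"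
  proof (rule measure_INT_eq_if_measure_UN_eq)
    show "?A j \<in> fmeasurable M" for j
      by (simp add: M.fmeasurable_eq_sets)
    show "?B j \<in> fmeasurable ?L" for j
      using B[of "{j}"] L[of "\<lambda>k. if k \<in> {j} then q k else 0"] q by (auto simp: fmeasurable_def)
    fix J :: "'d set"
    have "(\<Union>j\<in>J. ?A j) = {\<omega> \<in> space M. \<exists>j\<in>J. X \<omega> j > ereal (x j)}"
      by auto
    \<comment> \<open>Needed since \<open>ennreal\<close> truncates negative reals; here
      \<open>l\<close> is nonnegative because its value is a probability.\<close>
    moreover have "0 \<le> l (\<lambda>j. if j \<in> J then q j else 0)"
      using meas[of J] by (metis measure_nonneg)
    ultimately show "measure M (\<Union>j\<in>J. ?A j) = measure ?L (\<Union>j\<in>J. ?B j)"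
      unfolding B using meas[of J] L(1)[of "\<lambda>j. if j \<in> J then q j else 0"] q by (simp add: measure_def)
  qed auto
  moreover have "(\<Inter>j. ?A j) = {\<omega> \<in> space M. \<forall>j. X \<omega> j > ereal (x j)}" "(\<Inter>j. ?B j) = {z. \<forall>j. z j < ennreal (p j)}"
    by auto
  moreover have "tail_copula l p = measure ?L {z. \<forall>j. z j < ennreal (p j)}"
    using q by (intro tail_copula_eq_less) (simp add: \<open>p = q\<close>)
  moreover have "\<P>(\<omega> in M. \<exists>j. X \<omega> j > ereal (x j)) = l p"
    using meas[of UNIV] by (simp add: \<open>p = q\<close>)
  ultimately show ?thesis
    unfolding p_def by simp
qed

end
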